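(* Let $a<b$ be integers, let $w,f:\{a,a+1,\ldots,b-1,b\}\to\mathbb{R}$ and $\psi:[0,1]\to[0,1]$ be functions. For $\lambda\in[0,1]$ and $s,t\in\{a,\ldots,b\}$ put $$K(s,t)=\begin{cases} w(s)-\left(w(a)+\psi(\lambda)\frac{w(b)-w(a)}{2}\right), & a\le s<t,\\ w(s)-\left(w(a)+(1+\psi(1-\lambda))\frac{w(b)-w(a)}{2}\right), & t\le s\le b.\end{cases}$$ Then for all $x\in\{a,a+1,\ldots,b-1,b\}$ and all $\lambda\in[0,1]$, $$\begin{aligned} &\Bigg|\left[\frac{1+\psi(1-\lambda)-\psi(\lambda)}{2(b-a)}f(x)+\frac{\psi(\lambda)f(a)+(1-\psi(1-\lambda))f(b)}{2(b-a)}\right]\sum_{t=a}^{b-1}\Delta w(t)\\ &\quad-\frac{1}{b-a}\sum_{t=a}^{b-1}\Delta w(t)f(t+1)-\frac{f(b)-f(a)}{(b-a)^2}\sum_{t=a}^{b-1}K(t,x)\Bigg|\\ &\le\left[\frac{1}{b-a}\sum_{t=a}^{b-1}K^2(t,x)-\left(\frac{1}{b-a}\sum_{t=a}^{b-1}K(t,x)\right)^2\right]^{1/2}\\ &\quad\times\left[\frac{1}{b-a}\sum_{t=a}^{b-1}\left(\Delta f(t)\right)^2-\left(\frac{1}{b-a}\sum_{t=a}^{b-1}\Delta f(t)\right)^2\right]^{1/2}. \end{aligned}$$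
   Context: $\Delta$ denotes the forward difference operator: $\Delta\xi(t)=\xi(t+1)-\xi(t)$. *)

theory Defs
  imports Complex_Main
begin

definition fdiff :: "(int \<Rightarrow> real) \<Rightarrow> int \<Rightarrow> real"  (\<open>\<Delta>\<close>)
  where "\<Delta> \<xi> t = \<xi> (t + 1) - \<xi> t"

text \<open>Functions on the integers of \<open>[a, b]\<close> are represented by total functions on \<^typ>\<open>int\<close>;
  the kernel is only meaningful for \<open>s, t \<in> {a..b}\<close>, where the two branches of the
  conditional are exactly \<open>a \<le> s < t\<close> and \<open>t \<le> s \<le> b\<close>.\<close>

definition montgomery_kernel ::
    "int \<Rightarrow> int \<Rightarrow> (int \<Rightarrow> real) \<Rightarrow> (real \<Rightarrow> real) \<Rightarrow> real \<Rightarrow> int \<Rightarrow> int \<Rightarrow> real"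
  where "montgomery_kernel a b w \<psi> lam s t =
    (if s < t then w s - (w a + \<psi> lam * ((w b - w a) / 2))
     else w s - (w a + (1 + \<psi> (1 - lam)) * ((w b - w a) / 2)))"

end

theory Submission
  imports Defs "HOL-Analysis.Convex"
begin

text \<open>Summation by parts, applied separately on the two ranges on which the kernel equals \<open>w\<close> up to
  a constant, shows that the quantity inside the absolute value is the covariance of \<open>K(\<cdot>, x)\<close> and
  \<open>\<Delta> f\<close> for the uniform distribution on \<open>{a..b-1}\<close>. The bound is then the Cauchy--Schwarz
  inequality for the two centred functions.\<close>

lemma sum_diff_mean_mult:
  fixes g h :: "'a \<Rightarrow> real"
  assumes "finite A" "A \<noteq> {}"
  defines "n \<equiv> real (card A)"
  shows "(\<Sum>t\<in>A. (g t - sum g A / n) * (h t - sum h A / n)) / n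
    = (\<Sum>t\<in>A. g t * h t) / n - (sum g A / n) * (sum h A / n)"
proof -
  have n: "n \<noteq> 0"
    using assms by (simp add: n_def)
  have "(\<Sum>t\<in>A. (g t - c) * (h t - d))
      = (\<Sum>t\<in>A. g t * h t) - d * sum g A - c * sum h A + n * c * d" for c d
    by (simp add: n_def algebra_simps sum.distrib sum_subtractf sum_distrib_left)
  from this[of "sum g A / n" "sum h A / n"] show ?thesis
    using n by (simp add: diff_divide_distrib add_divide_distrib)
qed

lemma abs_covariance_le:
  fixes g h :: "'a \<Rightarrow> real"
  assumes "finite A" "A \<noteq> {}"
  defines "n \<equiv> real (card A)"
  shows "\<bar>(\<Sum>t\<in>A. g t * h t) / n - (sum g A / n) * (sum h A / n)\<bar>
    \<le> sqrt ((\<Sum>t\<in>A. (g t)\<^sup>2) / n - (sum g A / n)\<^sup>2)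
      * sqrt ((\<Sum>t\<in>A. (h t)\<^sup>2) / n - (sum h A / n)\<^sup>2)"
proof -
  define G where "G t = g t - sum g A / n" for t
  define H where "H t = h t - sum h A / n" for t
  have n: "n > 0"
    using assms by (simp add: n_def card_gt_0_iff)
  have "((\<Sum>t\<in>A. G t * H t) / n)\<^sup>2 \<le> ((\<Sum>t\<in>A. (G t)\<^sup>2) / n) * ((\<Sum>t\<in>A. (H t)\<^sup>2) / n)"
    using Cauchy_Schwarz_ineq_sum[of G H A] n
    by (simp add: power2_eq_square divide_right_mono)
  then have "sqrt (((\<Sum>t\<in>A. G t * H t) / n)\<^sup>2)
      \<le> sqrt ((\<Sum>t\<in>A. (G t)\<^sup>2) / n) * sqrt ((\<Sum>t\<in>A. (H t)\<^sup>2) / n)"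
    by (simp only: real_sqrt_le_iff flip: real_sqrt_mult)
  moreover have "(\<Sum>t\<in>A. G t * H t) / n = (\<Sum>t\<in>A. g t * h t) / n - (sum g A / n) * (sum h A / n)"
    unfolding G_def H_def n_def by (rule sum_diff_mean_mult[OF assms(1,2)])
  moreover have "(\<Sum>t\<in>A. (G t)\<^sup>2) / n = (\<Sum>t\<in>A. (g t)\<^sup>2) / n - (sum g A / n)\<^sup>2"
    unfolding G_def n_def power2_eq_square by (rule sum_diff_mean_mult[OF assms(1,2)])
  moreover have "(\<Sum>t\<in>A. (H t)\<^sup>2) / n = (\<Sum>t\<in>A. (h t)\<^sup>2) / n - (sum h A / n)\<^sup>2"
    unfolding H_def n_def power2_eq_square by (rule sum_diff_mean_mult[OF assms(1,2)])
  ultimately show ?thesis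
    by (simp only: real_sqrt_abs)
qed

lemma sum_fdiff:
  assumes "a \<le> b"
  shows "(\<Sum>t=a..b-1. \<Delta> f t) = f b - f a"
  using assms
proof (induction b rule: int_ge_induct)
  case (step i)
  then have "{a..i + 1 - 1} = insert i {a..i - 1}"
    by auto
  with step show ?case
    by (simp add: fdiff_def)
qed simp

lemma sum_mult_fdiff:
  assumes "a \<le> b"
  shows "(\<Sum>t=a..b-1. w t * \<Delta> f t) = w b * f b - w a * f a - (\<Sum>t=a..b-1. \<Delta> w t * f (t + 1))"
proof -
  have "(\<Sum>t=a..b-1. w t * \<Delta> f t) + (\<Sum>t=a..b-1. \<Delta> w t * f (t + 1)) = (\<Sum>t=a..b-1. \<Delta> (\<lambda>t. w t * f t) t)"
    unfolding sum.distrib[symmetric] by (simp add: fdiff_def algebra_simps)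
  then show ?thesis
    by (simp add: sum_fdiff[OF assms])
qed

lemma montgomery_identity:
  assumes "x \<in> {a..b}"
  shows "(\<Sum>t=a..b-1. montgomery_kernel a b w \<psi> lam t x * \<Delta> f t)
    = ((1 + \<psi> (1 - lam) - \<psi> lam) * f x + \<psi> lam * f a + (1 - \<psi> (1 - lam)) * f b) / 2
        * (w b - w a)
      - (\<Sum>t=a..b-1. \<Delta> w t * f (t + 1))"
proof -
  define c d where "c = w a + \<psi> lam * ((w b - w a) / 2)"
    and "d = w a + (1 + \<psi> (1 - lam)) * ((w b - w a) / 2)"
  have split: "{a..b-1} = {a..x-1} \<union> {x..b-1}"
    using assms by auto
  have "(\<Sum>t=a..b-1. montgomery_kernel a b w \<psi> lam t x * \<Delta> f t)
      = (\<Sum>t=a..b-1. w t * \<Delta> f t - (if t < x then c else d) * \<Delta> f t)"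
    by (rule sum.cong) (auto simp: montgomery_kernel_def c_def d_def algebra_simps)
  also have "\<dots> = (\<Sum>t=a..b-1. w t * \<Delta> f t) - (\<Sum>t=a..b-1. (if t < x then c else d) * \<Delta> f t)"
    by (rule sum_subtractf)
  also have "(\<Sum>t=a..b-1. (if t < x then c else d) * \<Delta> f t)
      = (\<Sum>t=a..x-1. (if t < x then c else d) * \<Delta> f t) + (\<Sum>t=x..b-1. (if t < x then c else d) * \<Delta> f t)"
    unfolding split by (rule sum.union_disjoint) auto
  also have "\<dots> = c * (f x - f a) + d * (f b - f x)"
    using assms by (simp add: sum_fdiff flip: sum_distrib_left)
  also have "(\<Sum>t=a..b-1. w t * \<Delta> f t) = w b * f b - w a * f a - (\<Sum>t=a..b-1. \<Delta> w t * f (t + 1))"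
    using assms by (simp add: sum_mult_fdiff)
  finally show ?thesis
    by (simp add: c_def d_def field_simps)
qed

theorem corollary28:
  fixes a b x :: int and w f :: "int \<Rightarrow> real" and \<psi> :: "real \<Rightarrow> real" and lam :: real
  assumes "a < b"
    and "\<psi> ` {0..1} \<subseteq> {0..1}"
    and "x \<in> {a..b}"
    and "lam \<in> {0..1}"
  shows
    "\<bar>((1 + \<psi> (1 - lam) - \<psi> lam) / (2 * (b - a)) * f x
        + (\<psi> lam * f a + (1 - \<psi> (1 - lam)) * f b) / (2 * (b - a))) * (\<Sum>t=a..b-1. \<Delta> w t)
      - 1 / (b - a) * (\<Sum>t=a..b-1. \<Delta> w t * f (t + 1))
      - (f b - f a) / (b - a)^2 * (\<Sum>t=a..b-1. montgomery_kernel a b w \<psi> lam t x)\<bar>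
     \<le> sqrt (1 / (b - a) * (\<Sum>t=a..b-1. (montgomery_kernel a b w \<psi> lam t x)^2) - (1 / (b - a) * (\<Sum>t=a..b-1. montgomery_kernel a b w \<psi> lam t x))^2)
      * sqrt (1 / (b - a) * (\<Sum>t=a..b-1. (\<Delta> f t)^2) - (1 / (b - a) * (\<Sum>t=a..b-1. \<Delta> f t))^2)"
proof -
  let ?K = "\<lambda>t. montgomery_kernel a b w \<psi> lam t x"
  define n where "n = real_of_int (b - a)"
  have n: "n > 0" and card: "real (card {a..b-1}) = n"
    using assms(1) by (auto simp: n_def)
  have "((1 + \<psi> (1 - lam) - \<psi> lam) / (2 * n) * f x
        + (\<psi> lam * f a + (1 - \<psi> (1 - lam)) * f b) / (2 * n)) * (w b - w a)
      - 1 / n * (\<Sum>t=a..b-1. \<Delta> w t * f (t + 1)) - (f b - f a) / n^2 * sum ?K {a..b-1}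
    = (\<Sum>t=a..b-1. ?K t * \<Delta> f t) / n - (sum ?K {a..b-1} / n) * ((f b - f a) / n)"
    unfolding montgomery_identity[OF assms(3)] using n
    by (simp add: field_simps power2_eq_square)
  then show ?thesis
    using abs_covariance_le[of "{a..b-1}" ?K "\<Delta> f"] assms(1)
    by (simp add: card sum_fdiff n_def)
qed

end
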